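(* Let $E$ be a finite graph. For $v\in P(E)$ let $\langle v\rangle$ be the $\mathbb Z$-order ideal of the talented monoid $T_E$ generated by $v$. Then, for all $v,w\in P(E)$: (1) $\langle v\rangle=\langle w\rangle$ if and only if $[v]=[w]$ in $P(E)/\!\sim$. (2) $\langle v\rangle$ is indecomposable as a $\mathbb Z$-order ideal. (3) $\langle v\rangle$ is simple as a $\mathbb Z$-order ideal if and only if $v$ is a sink, or $v$ belongs to a cycle without exits or to an extreme cycle. (4) For any $\mathbb Z$-order ideal $I$ of $T_E$, we have the decomposition $$I=\sum_{[v]\in\max(C(I))}\langle v\rangle.$$
   Context: A graph $E=(E^0,E^1,r,s)$ is a directed graph with vertex set $E^0$, edge set $E^1$ (here both finite), and range and source maps $r,s:E^1\to E^0$. A vertex $v$ is regular if $s^{-1}(v)\ne\varnothing$, otherwise a sink. A path is a sequence of edges $e_1\cdots e_n$ with $r(e_i)=s(e_{i+1})$ (source $s(e_1)$, range $r(e_n)$); vertices are paths of length $0$. For vertices, $u\ge v$ means there is a path from $u$ to $v$. A cycle is a path $\mathfrak c=e_1\cdots e_n$, $n\ge1$, with $r(e_n)=s(e_1)$ and $s(e_i)\ne s(e_j)$ for $i\ne j$; $\mathfrak c^0=\{s(e_1),\dots,s(e_n)\}$ is its set of vertices. An exit of $\mathfrak c$ is an edge $f$ with $s(f)=s(e_i)$ for some $i$ but $f\neq e_i$. An extreme cycle is a cycle $\mathfrak c$ which has an exit and such that every finite path that exits from it admits a return, i.e. for every path $\alpha$ whose first edge is an exit of $\mathfrak c$ there is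 a path $\mu$ with $s(\mu)=r(\alpha)$ and $r(\mu)\in\mathfrak c^0$. $P(E)$ is the set of all vertices that are sinks or lie on a cycle. On $P(E)$, $v\sim w$ iff $v\ge w$ and $w\ge v$; $[v]$ is the $\sim$-class of $v$; $P(E)/\!\sim$ is partially ordered by $[v]\ge[w]$ iff $v\ge w$. The talented monoid $T_E$ is the commutative monoid generated by $\{v(i)\mid v\in E^0,i\in\mathbb Z\}$ subject to $v(i)=\sum_{e\in s^{-1}(v)}r(e)(i+1)$ for all $i\in\mathbb Z$ and all regular vertices $v$; $\mathbb Z$ acts by ${}^n v(i)=v(i+n)$, and $v(0)$ is written $v$. On a commutative monoid, $a\le b$ iff $b=a+c$ for some $c$. A $\mathbb Z$-order ideal of $T_E$ is a submonoid $I$ closed under the $\mathbb Z$-action and such that $x\in I$, $y\le x$ imply $y\in I$. Sums of $\mathbb Z$-order ideals are sets of finite sums of elements. A $\mathbb Z$-order ideal is indecomposable if it is not of the form $J+K$ with $J,K$ nonzero $\mathbb Z$-order ideals of $T_E$ satisfying $J\cap K=\{0\}$; it is simple if it is nonzero and contains no $\mathbb Z$-order ideals other than $\{0\}$ and itself. For a $\mathbb Z$-order ideal $I$, $C(I)=\{[v]\mid v\in P(E),\ v\in I\}$, and $\max(C(I))$ is the set of maximal elements of $C(I)$ for the partial order on $P(E)/\!\sim$ given by $[v]\ge[w]$ iff $v\ge w$ (i.e. iff there is a path in $E$ from $v$ to $w$). *)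

theory Defs
  imports
    "Graph_Theory.Arc_Walk"
    "HOL-Algebra.Divisibility"
    "HOL-Algebra.FiniteProduct"
    "HOL-Library.Multiset"
begin

text \<open>
  A finite graph is a \<^locale>\<open>fin_digraph\<close>, which allows loops and parallel arcs; the source and
  range maps are \<^const>\<open>tail\<close> and \<^const>\<open>head\<close>. Paths are arc walks
  \<^const>\<open>pre_digraph.awalk\<close>, whose empty instances are the paths of length 0, and
  \<open>u \<ge> v\<close> is \<^const>\<open>reachable\<close>. The distinctness condition in \<^const>\<open>pre_digraph.cycle\<close> is
  on the ranges of the arcs, which along a closed path are the sources, cyclically shifted.
\<close>

definition regular :: "('v, 'e) pre_digraph \<Rightarrow> 'v \<Rightarrow> bool" where
  "regular E v \<longleftrightarrow> v \<in> verts E \<and> out_arcs E v \<noteq> {}"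

definition sink :: "('v, 'e) pre_digraph \<Rightarrow> 'v \<Rightarrow> bool" where
  "sink E v \<longleftrightarrow> v \<in> verts E \<and> out_arcs E v = {}"

definition cycle_verts :: "('v, 'e) pre_digraph \<Rightarrow> 'e list \<Rightarrow> 'v set" where
  "cycle_verts E c = tail E ` set c"

definition is_exit :: "('v, 'e) pre_digraph \<Rightarrow> 'e list \<Rightarrow> 'e \<Rightarrow> bool" where
  "is_exit E c f \<longleftrightarrow> f \<in> arcs E \<and> (\<exists>i < length c. tail E f = tail E (c ! i) \<and> f \<noteq> c ! i)"

definition extreme_cycle :: "('v, 'e) pre_digraph \<Rightarrow> 'e list \<Rightarrow> bool" where
  "extreme_cycle E c \<longleftrightarrow>
     pre_digraph.cycle E c \<and> (\<exists>f. is_exit E c f) \<and>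
     (\<forall>u p v. pre_digraph.awalk E u p v \<and> p \<noteq> [] \<and> is_exit E c (hd p) \<longrightarrow>
        (\<exists>q w. pre_digraph.awalk E v q w \<and> w \<in> cycle_verts E c))"

definition PE :: "('v, 'e) pre_digraph \<Rightarrow> 'v set" where
  "PE E = {v \<in> verts E. sink E v \<or> (\<exists>c. pre_digraph.cycle E c \<and> v \<in> cycle_verts E c)}"

definition PE_rel :: "('v, 'e) pre_digraph \<Rightarrow> 'v rel" where
  "PE_rel E = {(v, w). v \<in> PE E \<and> w \<in> PE E \<and> v \<rightarrow>\<^sup>*\<^bsub>E\<^esub> w \<and> w \<rightarrow>\<^sup>*\<^bsub>E\<^esub> v}"

definition PE_class :: "('v, 'e) pre_digraph \<Rightarrow> 'v \<Rightarrow> 'v set" where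
  "PE_class E v = PE_rel E `` {v}"

definition class_ge :: "('v, 'e) pre_digraph \<Rightarrow> 'v set \<Rightarrow> 'v set \<Rightarrow> bool" where
  "class_ge E X Y \<longleftrightarrow> (\<exists>v\<in>X. \<exists>w\<in>Y. v \<rightarrow>\<^sup>*\<^bsub>E\<^esub> w)"

text \<open>
  The free commutative monoid on the generators \<open>v(i)\<close> is the set of multisets of pairs
  \<open>(v, i)\<close>. \<open>tcong E\<close> is the smallest congruence on it that contains the defining relations.
\<close>

definition free_gens :: "('v, 'e) pre_digraph \<Rightarrow> ('v \<times> int) multiset set" where
  "free_gens E = {x. set_mset x \<subseteq> verts E \<times> UNIV}"

inductive tcong :: "('v, 'e) pre_digraph \<Rightarrow> ('v \<times> int) multiset \<Rightarrow> ('v \<times> int) multiset \<Rightarrow> bool"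
  for E where
  base: "regular E v \<Longrightarrow>
    tcong E {#(v, i)#} (image_mset (\<lambda>e. (head E e, i + 1)) (mset_set (out_arcs E v)))"
| refl: "x \<in> free_gens E \<Longrightarrow> tcong E x x"
| sym: "tcong E x y \<Longrightarrow> tcong E y x"
| trans: "tcong E x y \<Longrightarrow> tcong E y z \<Longrightarrow> tcong E x z"
| add: "tcong E x y \<Longrightarrow> tcong E x' y' \<Longrightarrow> tcong E (x + x') (y + y')"

definition tclass :: "('v, 'e) pre_digraph \<Rightarrow> ('v \<times> int) multiset \<Rightarrow> ('v \<times> int) multiset set" where
  "tclass E x = {y. tcong E x y}"

text \<open>
  The library's commutative monoids are written multiplicatively, so the sum in the talented
  monoid is \<open>\<otimes>\<close>, its zero is \<open>\<one>\<close>, finite sums are \<^const>\<open>finprod\<close>, the sum \<open>J + K\<close> of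
  two subsets is \<open>J <#> K\<close>, and the order \<open>a \<le> b\<close> (that is, \<open>b = a + c\<close> for some \<open>c\<close>) is
  \<open>a divides b\<close>.
\<close>

definition talented_monoid :: "('v, 'e) pre_digraph \<Rightarrow> ('v \<times> int) multiset set monoid" where
  "talented_monoid E =
     \<lparr>carrier = tclass E ` free_gens E,
      mult = (\<lambda>A B. \<Union>a\<in>A. \<Union>b\<in>B. tclass E (a + b)),
      one = tclass E {#}\<rparr>"

definition gen :: "('v, 'e) pre_digraph \<Rightarrow> 'v \<Rightarrow> int \<Rightarrow> ('v \<times> int) multiset set" where
  "gen E v i = tclass E {#(v, i)#}"

text \<open>
  The congruence is invariant under shifting, so the pointwise image of a class is again a class
  (see \<open>tshift_tclass\<close> below).
\<close>

definition tshift :: "int \<Rightarrow> ('v \<times> int) multiset set \<Rightarrow> ('v \<times> int) multiset set" where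
  "tshift n A = image_mset (\<lambda>(v, i). (v, i + n)) ` A"

definition Z_order_ideal ::
    "('v, 'e) pre_digraph \<Rightarrow> ('v \<times> int) multiset set set \<Rightarrow> bool" where
  "Z_order_ideal E I \<longleftrightarrow>
     submonoid I (talented_monoid E) \<and>
     (\<forall>n. \<forall>x\<in>I. tshift n x \<in> I) \<and>
     (\<forall>x\<in>I. \<forall>y\<in>carrier (talented_monoid E). y divides\<^bsub>talented_monoid E\<^esub> x \<longrightarrow> y \<in> I)"

definition zero_ideal :: "('v, 'e) pre_digraph \<Rightarrow> ('v \<times> int) multiset set set" where
  "zero_ideal E = {\<one>\<^bsub>talented_monoid E\<^esub>}"

definition gen_ideal :: "('v, 'e) pre_digraph \<Rightarrow> 'v \<Rightarrow> ('v \<times> int) multiset set set" where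
  "gen_ideal E v = Z_order_ideal E hull {gen E v 0}"

definition ideal_sum ::
    "('v, 'e) pre_digraph \<Rightarrow> 'k set \<Rightarrow> ('k \<Rightarrow> ('v \<times> int) multiset set set)
      \<Rightarrow> ('v \<times> int) multiset set set" where
  "ideal_sum E A J =
     {finprod (talented_monoid E) f F |f F. finite F \<and> F \<subseteq> A \<and> (\<forall>k\<in>F. f k \<in> J k)}"

definition indecomposable_ideal ::
    "('v, 'e) pre_digraph \<Rightarrow> ('v \<times> int) multiset set set \<Rightarrow> bool" where
  "indecomposable_ideal E I \<longleftrightarrow>
     Z_order_ideal E I \<and>
     \<not> (\<exists>J K. Z_order_ideal E J \<and> J \<noteq> zero_ideal E \<and>
              Z_order_ideal E K \<and> K \<noteq> zero_ideal E \<and>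
              J \<inter> K = zero_ideal E \<and> I = J <#>\<^bsub>talented_monoid E\<^esub> K)"

definition simple_ideal ::
    "('v, 'e) pre_digraph \<Rightarrow> ('v \<times> int) multiset set set \<Rightarrow> bool" where
  "simple_ideal E I \<longleftrightarrow>
     Z_order_ideal E I \<and> I \<noteq> zero_ideal E \<and>
     (\<forall>J. Z_order_ideal E J \<and> J \<subseteq> I \<longrightarrow> J = zero_ideal E \<or> J = I)"

definition C_ideal ::
    "('v, 'e) pre_digraph \<Rightarrow> ('v \<times> int) multiset set set \<Rightarrow> 'v set set" where
  "C_ideal E I = {PE_class E v |v. v \<in> PE E \<and> gen E v 0 \<in> I}"

definition max_classes :: "('v, 'e) pre_digraph \<Rightarrow> 'v set set \<Rightarrow> 'v set set" where
  "max_classes E C = {X \<in> C. \<forall>Y\<in>C. class_ge E Y X \<longrightarrow> Y = X}"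


section \<open>Well-definedness\<close>

lemma tclass_eq_iff: "x \<in> free_gens E \<Longrightarrow> tclass E x = tclass E y \<longleftrightarrow> tcong E x y"
  unfolding tclass_def
  by (auto dest: tcong.refl intro: tcong.sym tcong.trans)

lemma add_free_gens: "x \<in> free_gens E \<Longrightarrow> y \<in> free_gens E \<Longrightarrow> x + y \<in> free_gens E"
  by (auto simp: free_gens_def)

lemma tclass_mult:
  assumes "x \<in> free_gens E" "y \<in> free_gens E"
  shows "tclass E x \<otimes>\<^bsub>talented_monoid E\<^esub> tclass E y = tclass E (x + y)"
  using assms unfolding talented_monoid_def tclass_def
  by (auto intro: tcong.refl tcong.trans[OF tcong.add])

lemma comm_monoid_talented_monoid: "comm_monoid (talented_monoid E)"
proof -
  have zero: "{#} \<in> free_gens E" by (simp add: free_gens_def)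
  have car: "carrier (talented_monoid E) = tclass E ` free_gens E"
    and one: "\<one>\<^bsub>talented_monoid E\<^esub> = tclass E {#}"
    by (simp_all add: talented_monoid_def)
  show ?thesis
    by (rule comm_monoidI)
       (auto simp: car one zero tclass_mult add_free_gens ac_simps)
qed

lemma tcong_shift:
  assumes "tcong E x y"
  shows "tcong E (image_mset (\<lambda>(v, i). (v, i + n)) x) (image_mset (\<lambda>(v, i). (v, i + n)) y)"
  using assms
proof induction
  case (base v i)
  then show ?case
    using tcong.base[of E v "i + n"] by (simp add: multiset.map_comp o_def ac_simps)
next
  case (refl x)
  then show ?case by (intro tcong.refl) (auto simp: free_gens_def)
qed (auto intro: tcong.sym tcong.trans tcong.add)

lemma tshift_tclass: "tshift n (tclass E x) = tclass E (image_mset (\<lambda>(v, i). (v, i + n)) x)"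
proof (intro equalityI subsetI)
  fix z assume "z \<in> tshift n (tclass E x)"
  then obtain y where "tcong E x y" "z = image_mset (\<lambda>(v, i). (v, i + n)) y"
    unfolding tshift_def tclass_def by blast
  then show "z \<in> tclass E (image_mset (\<lambda>(v, i). (v, i + n)) x)"
    unfolding tclass_def by (simp add: tcong_shift)
next
  fix z assume "z \<in> tclass E (image_mset (\<lambda>(v, i). (v, i + n)) x)"
  then have z: "tcong E (image_mset (\<lambda>(v, i). (v, i + n)) x) z"
    by (simp add: tclass_def)
  define y where "y = image_mset (\<lambda>(v, i). (v, i + - n)) z"
  have "tcong E x y"
    using tcong_shift[OF z, of "- n"]
    by (simp add: y_def multiset.map_comp o_def case_prod_unfold)
  moreover have "z = image_mset (\<lambda>(v, i). (v, i + n)) y"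
    by (simp add: y_def multiset.map_comp o_def case_prod_unfold)
  ultimately show "z \<in> tshift n (tclass E x)"
    unfolding tshift_def tclass_def by blast
qed

lemma class_ge_PE_class:
  assumes "fin_digraph E" "v \<in> PE E" "w \<in> PE E"
  shows "class_ge E (PE_class E v) (PE_class E w) \<longleftrightarrow> v \<rightarrow>\<^sup>*\<^bsub>E\<^esub> w"
proof -
  interpret fin_digraph E by fact
  have "v \<rightarrow>\<^sup>*\<^bsub>E\<^esub> v" "w \<rightarrow>\<^sup>*\<^bsub>E\<^esub> w"
    using assms by (auto simp: PE_def)
  then show ?thesis
    using assms unfolding class_ge_def PE_class_def PE_rel_def
    by (auto intro: reachable_trans)
qed

end

theory Submission
  imports Defs
begin

text \<open>
  Everything rests on a correspondence between the \<open>\<int>\<close>-order ideals of the talented monoid and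
  the sets \<open>H\<close> of vertices that contain a regular vertex exactly when they contain all its
  out-neighbours (the hereditary and saturated sets). For such an \<open>H\<close>, whether the vertices
  occurring in a multiset of generators all lie in \<open>H\<close> is invariant under the defining congruence:
  this holds for a single relation by the very definition of \<open>H\<close>, and it passes to sums
  (\<open>tcong_supported_iff\<close>). Hence the classes of the multisets supported in \<open>H\<close> form an ideal, and
  since an order ideal contains a sum iff it contains the summands, every ideal is of this form
  (\<open>Z_order_ideal_eq\<close>). Questions about ideals thus become questions about reachability.

  The vertices in \<open>PE E\<close> are those that are never forced into a saturated set from outside:
  for \<open>w \<in> PE E\<close> the set of vertices from which \<open>w\<close> cannot be reached is hereditary and
  saturated (\<open>hereditary_saturated_not_reaching\<close>). This separates vertices: \<open>w\<close> lies in the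
  ideal generated by \<open>v\<close> only if \<open>v\<close> reaches \<open>w\<close> (\<open>gen_in_gen_ideal_iff\<close>), so these ideals
  determine the classes. It also shows that if \<open>w\<close> equals \<open>a + b\<close> then some vertex occurring in \<open>a\<close>
  or in \<open>b\<close> reaches \<open>w\<close>; so if \<open>a\<close> and \<open>b\<close> belong to ideals, one of these ideals contains \<open>w\<close>
  (\<open>PE_gen_in_set_mult\<close>), which makes \<open>\<langle>w\<rangle>\<close> indecomposable.

  Conversely, \<open>PE E\<close> is large enough: as the graph is finite, replacing a vertex outside of \<open>PE E\<close>
  by its out-neighbours can be repeated only finitely often, so every generator is a sum of
  generators at vertices in \<open>PE E\<close> reached by it (\<open>tcong_PE_sum\<close>). So a nonzero ideal contains a
  vertex of \<open>PE E\<close>, and \<open>\<langle>v\<rangle>\<close> is simple iff everything reached from \<open>v\<close> reaches \<open>v\<close> again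
  (\<open>simple_gen_ideal_iff\<close>); for \<open>v\<close> on a cycle this says that the cycle has no exit or is extreme.
  It also reduces the decomposition of an ideal to generators at vertices of \<open>PE E\<close>, and each of
  these lies below a maximal class because there are finitely many classes.
\<close>

section \<open>Cycles and reachability\<close>

context fin_digraph
begin

lemma arc_reachable:
  assumes "e \<in> arcs G"
  shows "tail G e \<rightarrow>\<^sup>* head G e"
  using arc_implies_awalk[OF assms] by (rule reachable_awalkI)

lemma closed_awalk_reachable:
  assumes "awalk u p u" "e \<in> set p"
  shows "u \<rightarrow>\<^sup>* tail G e" "head G e \<rightarrow>\<^sup>* u"
proof -
  obtain p1 p2 where "p = p1 @ e # p2"
    using assms(2) by (meson split_list)
  with assms(1) have "awalk u p1 (tail G e)" "awalk (head G e) p2 u"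
    by (auto simp: awalk_Cons_iff)
  then show "u \<rightarrow>\<^sup>* tail G e" "head G e \<rightarrow>\<^sup>* u"
    by (auto intro: reachable_awalkI)
qed

lemma cycle_arc:
  assumes "cycle c" "e \<in> set c"
  shows "e \<in> arcs G"
  using assms by (auto simp: cycle_def awalk_def)

lemma cycle_verts_reachable:
  assumes "cycle c" "v \<in> cycle_verts G c" "w \<in> cycle_verts G c"
  shows "v \<rightarrow>\<^sup>* w"
proof -
  obtain u where u: "awalk u c u"
    using assms(1) by (auto simp: cycle_def)
  obtain e f where e: "e \<in> set c" "v = tail G e" and f: "f \<in> set c" "w = tail G f"
    using assms by (auto simp: cycle_verts_def)
  have "tail G e \<rightarrow>\<^sup>* head G e"
    using arc_reachable cycle_arc[OF assms(1) e(1)] .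
  also have "head G e \<rightarrow>\<^sup>* u"
    using u e(1) by (rule closed_awalk_reachable)
  also have "u \<rightarrow>\<^sup>* tail G f"
    using u f(1) by (rule closed_awalk_reachable)
  finally show ?thesis
    using e f by simp
qed

lemma head_in_cycle_verts:
  assumes "cycle c" "e \<in> set c"
  shows "head G e \<in> cycle_verts G c"
proof -
  obtain u where u: "awalk u c u" "c \<noteq> []"
    using assms(1) by (auto simp: cycle_def)
  \<comment> \<open>The arc following \<open>e\<close> starts in the head of \<open>e\<close>; if \<open>e\<close> is the last arc, this is the first one.\<close>
  obtain p1 p2 where c: "c = p1 @ e # p2"
    using assms(2) by (meson split_list)
  then have walk: "awalk (head G e) p2 u"
    using u(1) by (simp add: awalk_Cons_iff)
  show ?thesis
  proof (cases p2)
    case Nil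
    with walk have "head G e = tail G (hd c)"
      using u by (cases c) (auto simp: awalk_simps)
    then show ?thesis
      using u(2) by (simp add: cycle_verts_def)
  next
    case (Cons f q)
    with walk have "head G e = tail G f" "f \<in> set c"
      by (auto simp: awalk_Cons_iff c)
    then show ?thesis
      by (simp add: cycle_verts_def)
  qed
qed

lemma PE_iff: "v \<in> PE G \<longleftrightarrow> sink G v \<or> (\<exists>c. cycle c \<and> v \<in> cycle_verts G c)"
  by (auto simp: PE_def sink_def cycle_verts_def dest: cycle_arc)

lemma PE_in_verts: "v \<in> PE G \<Longrightarrow> v \<in> verts G"
  by (simp add: PE_def)

lemma finite_PE: "finite (PE G)"
  using finite_verts by (rule rev_finite_subset) (auto simp: PE_def)

text \<open>
  A closed walk through \<open>v\<close> can be shortened to a cycle through \<open>v\<close>: keep its first arc and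
  replace the rest by a walk back to \<open>v\<close> without repeated vertices.
\<close>

lemma returning_arc_PE:
  assumes "e \<in> arcs G" "head G e \<rightarrow>\<^sup>* tail G e"
  shows "tail G e \<in> PE G"
proof -
  obtain p where "apath (head G e) p (tail G e)"
    using assms(2) by (auto simp: reachable_apath)
  then have "awalk (tail G e) (e # p) (tail G e)" "distinct (awalk_verts (head G e) p)"
    using assms(1) by (auto simp: apath_def awalk_Cons_iff)
  then have "cycle (e # p)"
    by (auto simp: cycle_def)
  then show ?thesis
    by (auto simp: PE_iff cycle_verts_def)
qed

lemma PE_class_eq_iff:
  assumes "v \<in> PE G" "w \<in> PE G"
  shows "PE_class G v = PE_class G w \<longleftrightarrow> v \<rightarrow>\<^sup>* w \<and> w \<rightarrow>\<^sup>* v"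
proof -
  have "v \<rightarrow>\<^sup>* v" "w \<rightarrow>\<^sup>* w"
    using assms by (auto dest: PE_in_verts)
  then show ?thesis
    using assms unfolding PE_class_def PE_rel_def by (auto intro: reachable_trans)
qed

text \<open>
  The first arc outside of the cycle on a walk that starts on the cycle is an exit, since up to
  then the walk has visited vertices of the cycle only.
\<close>

lemma cycle_leave:
  assumes "cycle c" "v \<in> cycle_verts G c" "v \<rightarrow>\<^sup>* w"
  shows "w \<in> cycle_verts G c \<or> (\<exists>u p. awalk u p w \<and> p \<noteq> [] \<and> is_exit G c (hd p))"
  using assms(3)
proof (induction rule: reachable_induct)
  case base
  show ?case using assms(2) by simp
next
  case (step x y)
  obtain f where f: "f \<in> arcs G" "tail G f = x" "head G f = y"
    using step.hyps(2) by auto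
  from step.IH show ?case
  proof (elim disjE exE conjE)
    assume x: "x \<in> cycle_verts G c"
    show ?thesis
    proof (cases "f \<in> set c")
      case True
      then show ?thesis
        using head_in_cycle_verts[OF assms(1)] f by auto
    next
      case False
      obtain i where "i < length c" "x = tail G (c ! i)"
        using x by (auto simp: cycle_verts_def in_set_conv_nth)
      with False f have "is_exit G c f"
        by (auto simp: is_exit_def)
      moreover have "awalk x [f] y"
        using arc_implies_awalk[OF f(1)] f by simp
      ultimately show ?thesis
        by (metis list.sel(1) list.distinct(1))
    qed
  next
    fix u p
    assume p: "awalk u p x" "p \<noteq> []" "is_exit G c (hd p)"
    have "awalk u (p @ [f]) y"
      using awalk_appendI[OF p(1)] arc_implies_awalk[OF f(1)] f by simp
    moreover have "hd (p @ [f]) = hd p"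
      using p(2) by simp
    ultimately show ?thesis
      using p by (metis append_is_Nil_conv)
  qed
qed

text \<open>
  The three kinds of vertices in the simplicity criterion are exactly the vertices whose strongly
  connected component is not left by any walk.
\<close>

lemma returning_vertex_iff:
  assumes "v \<in> PE G"
  shows "(\<forall>w. v \<rightarrow>\<^sup>* w \<longrightarrow> w \<rightarrow>\<^sup>* v) \<longleftrightarrow>
    sink G v \<or>
    (\<exists>c. cycle c \<and> \<not> (\<exists>f. is_exit G c f) \<and> v \<in> cycle_verts G c) \<or>
    (\<exists>c. extreme_cycle G c \<and> v \<in> cycle_verts G c)"
    (is "?ret \<longleftrightarrow> _ \<or> ?noexit \<or> ?extreme")
proof (intro iffI)
  assume ret: ?ret
  show "sink G v \<or> ?noexit \<or> ?extreme"
  proof (rule ccontr)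
    assume "\<not> ?thesis"
    then obtain c f where c: "cycle c" "v \<in> cycle_verts G c" "is_exit G c f"
      and not_extreme: "\<not> extreme_cycle G c"
      using assms unfolding PE_iff by blast
    have "extreme_cycle G c"
      unfolding extreme_cycle_def
    proof (intro conjI allI impI)
      show "cycle c" "\<exists>f. is_exit G c f"
        using c by auto
    next
      fix u p w
      assume p: "awalk u p w \<and> p \<noteq> [] \<and> is_exit G c (hd p)"
      then have "u = tail G (hd p)"
        by (cases p) (auto simp: awalk_Cons_iff)
      with p have "u \<in> cycle_verts G c"
        by (auto simp: is_exit_def cycle_verts_def)
      then have "v \<rightarrow>\<^sup>* u"
        using cycle_verts_reachable c by blast
      also have "u \<rightarrow>\<^sup>* w"
        using p by (blast intro: reachable_awalkI)
      finally have "w \<rightarrow>\<^sup>* v"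
        using ret by blast
      then show "\<exists>q w'. awalk w q w' \<and> w' \<in> cycle_verts G c"
        using c unfolding reachable_awalk by blast
    qed
    with not_extreme show False ..
  qed
next
  assume "sink G v \<or> ?noexit \<or> ?extreme"
  then show ?ret
  proof (elim disjE exE conjE)
    assume "sink G v"
    then have "v \<in> verts G" "\<And>w. \<not> v \<rightarrow>\<^bsub>G\<^esub> w"
      by (auto simp: sink_def out_arcs_def)
    then show ?thesis
      by (metis converse_reachable_cases reachable_refl)
  next
    fix c
    assume c: "cycle c" "\<nexists>f. is_exit G c f" "v \<in> cycle_verts G c"
    show ?thesis
      using cycle_leave[OF c(1,3)] cycle_verts_reachable[OF c(1) _ c(3)] c(2) by blast
  next
    fix c
    assume c: "extreme_cycle G c" "v \<in> cycle_verts G c"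
    then have cyc: "cycle c"
      by (simp add: extreme_cycle_def)
    show ?thesis
    proof (intro allI impI)
      fix w
      assume "v \<rightarrow>\<^sup>* w"
      then consider "w \<in> cycle_verts G c"
        | u p where "awalk u p w" "p \<noteq> []" "is_exit G c (hd p)"
        using cycle_leave[OF cyc c(2)] by blast
      then show "w \<rightarrow>\<^sup>* v"
      proof cases
        case 1
        then show ?thesis
          using cycle_verts_reachable[OF cyc _ c(2)] by blast
      next
        case 2
        then obtain q x where "awalk w q x" "x \<in> cycle_verts G c"
          using c(1) unfolding extreme_cycle_def by blast
        then show ?thesis
          using cycle_verts_reachable[OF cyc _ c(2)] by (blast intro: reachable_awalkI reachable_trans)
      qed
    qed
  qed
qed

end

section \<open>Hereditary and saturated sets\<close>

text \<open>
  From left to right, the equivalence says that \<open>H\<close> is hereditary, from right to left that it is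
  saturated. \<open>H\<close> may contain elements that are not vertices, so that these sets are closed under
  all intersections, the empty one included, and the closure of a set is an instance of \<open>hull\<close>.
\<close>

definition hereditary_saturated :: "('v, 'e) pre_digraph \<Rightarrow> 'v set \<Rightarrow> bool" where
  "hereditary_saturated E H \<longleftrightarrow>
     (\<forall>v. regular E v \<longrightarrow> (v \<in> H \<longleftrightarrow> head E ` out_arcs E v \<subseteq> H))"

lemma hereditary_saturated_hull: "hereditary_saturated E (hereditary_saturated E hull S)"
proof (rule hull_in)
  fix T
  assume T: "\<forall>H\<in>T. hereditary_saturated E H"
  show "hereditary_saturated E (\<Inter>T)"
    unfolding hereditary_saturated_def
  proof (intro allI impI)
    fix v
    assume "regular E v"
    with T have "v \<in> H \<longleftrightarrow> head E ` out_arcs E v \<subseteq> H" if "H \<in> T" for H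
      using that by (simp add: hereditary_saturated_def)
    then show "v \<in> \<Inter>T \<longleftrightarrow> head E ` out_arcs E v \<subseteq> \<Inter>T"
      by (simp add: le_Inf_iff)
  qed
qed

lemma hereditary_saturated_empty: "hereditary_saturated E {}"
  by (auto simp: hereditary_saturated_def regular_def)

context fin_digraph
begin

lemma hereditary_reachable:
  assumes "hereditary_saturated G H" "v \<in> H" "v \<rightarrow>\<^sup>* w"
  shows "w \<in> H"
  using assms(3,2)
proof (induction rule: converse_reachable_induct)
  case (step x y)
  obtain e where "e \<in> out_arcs G x" "head G e = y"
    using step.hyps(1) by auto
  moreover from this have "regular G x"
    using wellformed by (auto simp: regular_def)
  ultimately have "y \<in> H"
    using assms(1) step.prems unfolding hereditary_saturated_def by blast
  then show ?case
    by (rule step.IH)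
qed

text \<open>
  If a regular vertex reaches \<open>w\<close>, so does one of its out-neighbours. For the vertex \<open>w\<close> itself
  this needs \<open>w \<in> PE G\<close>: being regular, \<open>w\<close> then lies on a cycle.
\<close>

lemma hereditary_saturated_not_reaching:
  assumes "w \<in> PE G"
  shows "hereditary_saturated G {u. \<not> u \<rightarrow>\<^sup>* w}"
  unfolding hereditary_saturated_def
proof (intro allI impI)
  fix v
  assume v: "regular G v"
  have "\<exists>e\<in>out_arcs G v. head G e \<rightarrow>\<^sup>* w" if "v \<rightarrow>\<^sup>* w"
    using that
  proof (cases rule: converse_reachable_cases)
    case base
    with v assms obtain c where c: "cycle c" "w \<in> cycle_verts G c"
      by (auto simp: PE_iff sink_def regular_def)
    then obtain e where e: "e \<in> set c" "w = tail G e"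
      by (auto simp: cycle_verts_def)
    then have "head G e \<rightarrow>\<^sup>* w"
      using cycle_verts_reachable[OF c(1)] head_in_cycle_verts[OF c(1)] c(2) by blast
    moreover have "e \<in> out_arcs G v"
      using e base cycle_arc[OF c(1)] by simp
    ultimately show ?thesis by blast
  next
    case (step u)
    then obtain e where "e \<in> out_arcs G v" "head G e = u"
      by auto
    with step(2) show ?thesis by blast
  qed
  moreover have "v \<rightarrow>\<^sup>* w" if "e \<in> out_arcs G v" "head G e \<rightarrow>\<^sup>* w" for e
    using that arc_reachable[of e] by (auto intro: reachable_trans)
  ultimately show "v \<in> {u. \<not> u \<rightarrow>\<^sup>* w} \<longleftrightarrow> head G ` out_arcs G v \<subseteq> {u. \<not> u \<rightarrow>\<^sup>* w}"
    unfolding mem_Collect_eq image_subset_iff by blast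
qed

section \<open>Supports of elements of the talented monoid\<close>

lemma tcong_free_gens:
  assumes "tcong G x y"
  shows "x \<in> free_gens G \<and> y \<in> free_gens G"
  using assms
  by induction (auto simp: free_gens_def regular_def finite_set_mset_mset_set[OF finite_out_arcs])

text \<open>
  The defining relations are applied in both directions here: unfolding a vertex stays in \<open>H\<close>
  because \<open>H\<close> is hereditary, folding stays in \<open>H\<close> because it is saturated.
\<close>

lemma tcong_supported_iff:
  assumes "tcong G x y" "hereditary_saturated G H"
  shows "fst ` set_mset x \<subseteq> H \<longleftrightarrow> fst ` set_mset y \<subseteq> H"
  using assms(1)
proof induction
  case (base v i)
  then show ?case
    using assms(2) unfolding hereditary_saturated_def
    by (simp add: image_image finite_set_mset_mset_set[OF finite_out_arcs])
next
  case (add x y x' y')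
  then show ?case
    by (simp add: image_Un)
qed auto

lemma tcong_sum_mset:
  assumes "\<And>p. p \<in># x \<Longrightarrow> tcong G {#p#} (y p)"
  shows "tcong G x (\<Sum>p\<in>#x. y p)"
  using assms
proof (induction x)
  case empty
  show ?case
    by (auto simp: free_gens_def intro: tcong.refl)
next
  case (add p x)
  then have "tcong G ({#p#} + x) (y p + (\<Sum>q\<in>#x. y q))"
    by (intro tcong.add) auto
  then show ?case by simp
qed

text \<open>
  A vertex outside of \<open>PE G\<close> is regular and is not reached from its out-neighbours, which
  therefore reach strictly fewer vertices.
\<close>

lemma tcong_PE_sum:
  assumes "v \<in> verts G"
  shows "\<exists>x. tcong G {#(v, i)#} x \<and> fst ` set_mset x \<subseteq> {w \<in> PE G. v \<rightarrow>\<^sup>* w}"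
  using assms
proof (induction "card {w. v \<rightarrow>\<^sup>* w}" arbitrary: v i rule: less_induct)
  case less
  show ?case
  proof (cases "v \<in> PE G")
    case True
    then show ?thesis
      using less.prems
      by (intro exI[of _ "{#(v, i)#}"]) (auto simp: free_gens_def intro: tcong.refl)
  next
    case False
    then have reg: "regular G v"
      using less.prems by (auto simp: PE_iff sink_def regular_def)
    let ?x = "image_mset (\<lambda>e. (head G e, i + 1)) (mset_set (out_arcs G v))"
    have "\<exists>y. tcong G {#p#} y \<and> fst ` set_mset y \<subseteq> {w \<in> PE G. v \<rightarrow>\<^sup>* w}" if p: "p \<in># ?x" for p
    proof -
      obtain e where e: "e \<in> arcs G" "tail G e = v" "p = (head G e, i + 1)"
        using p by (auto simp: finite_set_mset_mset_set[OF finite_out_arcs])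
      have reach: "{w. head G e \<rightarrow>\<^sup>* w} \<subseteq> {w. v \<rightarrow>\<^sup>* w}"
        using arc_reachable[OF e(1)] e(2) by (auto intro: reachable_trans)
      have "\<not> head G e \<rightarrow>\<^sup>* v"
        using returning_arc_PE[OF e(1)] e(2) False by blast
      then have "{w. head G e \<rightarrow>\<^sup>* w} \<subset> {w. v \<rightarrow>\<^sup>* w}"
        using reach less.prems by blast
      moreover have "finite {w. v \<rightarrow>\<^sup>* w}"
        using finite_verts by (rule rev_finite_subset) (auto dest: reachable_in_verts)
      ultimately have "card {w. head G e \<rightarrow>\<^sup>* w} < card {w. v \<rightarrow>\<^sup>* w}"
        by (intro psubset_card_mono)
      then obtain y where "tcong G {#(head G e, i + 1)#} y"
          "fst ` set_mset y \<subseteq> {w \<in> PE G. head G e \<rightarrow>\<^sup>* w}"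
        using less.hyps[of "head G e" "i + 1"] e(1) by auto
      then show ?thesis
        using reach e(3) by blast
    qed
    then have "\<forall>p\<in>set_mset ?x. \<exists>y. tcong G {#p#} y \<and> fst ` set_mset y \<subseteq> {w \<in> PE G. v \<rightarrow>\<^sup>* w}"
      by (intro ballI)
    from bchoice[OF this] obtain y where
        y: "\<forall>p\<in>set_mset ?x. tcong G {#p#} (y p) \<and>
              fst ` set_mset (y p) \<subseteq> {w \<in> PE G. v \<rightarrow>\<^sup>* w}" ..
    have "tcong G ?x (\<Sum>p\<in>#?x. y p)"
      by (rule tcong_sum_mset) (use y in blast)
    with tcong.base[OF reg] have "tcong G {#(v, i)#} (\<Sum>p\<in>#?x. y p)"
      by (rule tcong.trans)
    moreover have "fst ` set_mset (\<Sum>p\<in>#?x. y p) = (\<Union>p\<in>set_mset ?x. fst ` set_mset (y p))"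
      by (simp only: set_mset_Union_mset set_image_mset image_UN image_image)
    then have "fst ` set_mset (\<Sum>p\<in>#?x. y p) \<subseteq> {w \<in> PE G. v \<rightarrow>\<^sup>* w}"
      using y by blast
    ultimately show ?thesis by blast
  qed
qed

end

section \<open>Ideals and hereditary saturated sets\<close>

lemma carrier_talented_monoid: "carrier (talented_monoid E) = tclass E ` free_gens E"
  by (simp add: talented_monoid_def)

lemma one_talented_monoid: "\<one>\<^bsub>talented_monoid E\<^esub> = tclass E {#}"
  by (simp add: talented_monoid_def)

lemma empty_free_gens: "{#} \<in> free_gens E"
  by (simp add: free_gens_def)

lemma singleton_free_gens: "{#(v, i)#} \<in> free_gens E \<longleftrightarrow> v \<in> verts E"
  by (simp add: free_gens_def)

lemma tshift_gen: "tshift n (gen E v i) = gen E v (i + n)"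
  by (simp add: gen_def tshift_tclass)

definition vertex_ideal ::
    "('v, 'e) pre_digraph \<Rightarrow> 'v set \<Rightarrow> ('v \<times> int) multiset set set" where
  "vertex_ideal E H = tclass E ` {x \<in> free_gens E. fst ` set_mset x \<subseteq> H}"

definition ideal_verts ::
    "('v, 'e) pre_digraph \<Rightarrow> ('v \<times> int) multiset set set \<Rightarrow> 'v set" where
  "ideal_verts E I = {v. gen E v 0 \<in> I}"

lemma vertex_ideal_mono: "H \<subseteq> K \<Longrightarrow> vertex_ideal E H \<subseteq> vertex_ideal E K"
  by (auto simp: vertex_ideal_def)

lemma Z_order_ideal_one: "Z_order_ideal E I \<Longrightarrow> \<one>\<^bsub>talented_monoid E\<^esub> \<in> I"
  by (simp add: Z_order_ideal_def submonoid.one_closed)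

lemma Z_order_ideal_subset: "Z_order_ideal E I \<Longrightarrow> I \<subseteq> carrier (talented_monoid E)"
  by (simp add: Z_order_ideal_def submonoid.subset)

lemma Z_order_idealE:
  assumes "Z_order_ideal E I" "a \<in> I"
  obtains x where "x \<in> free_gens E" "a = tclass E x"
  using Z_order_ideal_subset[OF assms(1)] assms(2) unfolding carrier_talented_monoid by blast

text \<open>
  An order ideal contains a sum iff it contains the summands: it is closed under sums, and each
  summand is below the sum.
\<close>

lemma Z_order_ideal_add_iff:
  assumes "Z_order_ideal E I" "x \<in> free_gens E" "y \<in> free_gens E"
  shows "tclass E (x + y) \<in> I \<longleftrightarrow> tclass E x \<in> I \<and> tclass E y \<in> I"
proof
  assume xy: "tclass E (x + y) \<in> I"
  have "tclass E x divides\<^bsub>talented_monoid E\<^esub> tclass E (x + y)"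
       "tclass E y divides\<^bsub>talented_monoid E\<^esub> tclass E (x + y)"
    using assms(2,3) tclass_mult[of x E y] tclass_mult[of y E x]
    by (auto simp: factor_def carrier_talented_monoid add.commute)
  then show "tclass E x \<in> I \<and> tclass E y \<in> I"
    using assms xy unfolding Z_order_ideal_def carrier_talented_monoid by blast
next
  assume "tclass E x \<in> I \<and> tclass E y \<in> I"
  then have "tclass E x \<otimes>\<^bsub>talented_monoid E\<^esub> tclass E y \<in> I"
    using assms(1) by (simp add: Z_order_ideal_def submonoid.m_closed)
  then show "tclass E (x + y) \<in> I"
    using assms by (simp add: tclass_mult)
qed

lemma Z_order_ideal_gen_iff:
  assumes "Z_order_ideal E I"
  shows "gen E v i \<in> I \<longleftrightarrow> v \<in> ideal_verts E I"
proof -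
  have "gen E v j \<in> I" if "gen E v i \<in> I" for i j
  proof -
    have "tshift (j - i) (gen E v i) \<in> I"
      using assms that by (simp add: Z_order_ideal_def)
    then show ?thesis
      by (simp add: tshift_gen)
  qed
  then show ?thesis
    unfolding ideal_verts_def by blast
qed

lemma tclass_in_ideal_iff:
  assumes "Z_order_ideal E I" "x \<in> free_gens E"
  shows "tclass E x \<in> I \<longleftrightarrow> fst ` set_mset x \<subseteq> ideal_verts E I"
  using assms(2)
proof (induction x)
  case empty
  show ?case
    using Z_order_ideal_one[OF assms(1)] by (simp add: one_talented_monoid)
next
  case (add p x)
  then have p: "{#p#} \<in> free_gens E" and x: "x \<in> free_gens E"
    by (auto simp: free_gens_def)
  have "tclass E ({#p#} + x) \<in> I \<longleftrightarrow> gen E (fst p) (snd p) \<in> I \<and> tclass E x \<in> I"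
    unfolding Z_order_ideal_add_iff[OF assms(1) p x] by (simp add: gen_def)
  then show ?case
    using add.IH[OF x] by (simp add: Z_order_ideal_gen_iff[OF assms(1)])
qed

lemma Z_order_ideal_eq:
  assumes "Z_order_ideal E I"
  shows "I = vertex_ideal E (ideal_verts E I)"
proof -
  have "I = tclass E ` {x \<in> free_gens E. tclass E x \<in> I}"
    using Z_order_ideal_subset[OF assms] by (auto simp: carrier_talented_monoid)
  also have "\<dots> = vertex_ideal E (ideal_verts E I)"
    unfolding vertex_ideal_def using tclass_in_ideal_iff[OF assms] by (intro image_cong) auto
  finally show ?thesis .
qed

lemma gen_ideal_subset:
  assumes "Z_order_ideal E I" "v \<in> ideal_verts E I"
  shows "gen_ideal E v \<subseteq> I"
  unfolding gen_ideal_def using assms by (intro hull_minimal) (auto simp: ideal_verts_def)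

lemma gen_in_gen_ideal: "v \<in> ideal_verts E (gen_ideal E v)"
  unfolding gen_ideal_def ideal_verts_def by (auto intro: hull_inc)

context fin_digraph
begin

lemma hereditary_saturated_ideal_verts:
  assumes "Z_order_ideal G I"
  shows "hereditary_saturated G (ideal_verts G I)"
  unfolding hereditary_saturated_def
proof (intro allI impI)
  fix v
  assume v: "regular G v"
  let ?x = "image_mset (\<lambda>e. (head G e, 0 + 1)) (mset_set (out_arcs G v)) :: ('a \<times> int) multiset"
  have cong: "tcong G {#(v, 0)#} ?x"
    using v by (rule tcong.base)
  then have "?x \<in> free_gens G" "{#(v, 0 :: int)#} \<in> free_gens G"
    using tcong_free_gens by auto
  moreover have "tclass G {#(v, 0)#} = tclass G ?x"
    using cong \<open>{#(v, 0)#} \<in> free_gens G\<close> by (simp add: tclass_eq_iff)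
  ultimately show "v \<in> ideal_verts G I \<longleftrightarrow> head G ` out_arcs G v \<subseteq> ideal_verts G I"
    using tclass_in_ideal_iff[OF assms, of ?x] tclass_in_ideal_iff[OF assms, of "{#(v, 0)#}"]
    by (simp add: image_image finite_set_mset_mset_set[OF finite_out_arcs])
qed

lemma tclass_in_vertex_ideal_iff:
  assumes "hereditary_saturated G H" "x \<in> free_gens G"
  shows "tclass G x \<in> vertex_ideal G H \<longleftrightarrow> fst ` set_mset x \<subseteq> H"
  using tcong_supported_iff[OF _ assms(1)] assms(2)
  unfolding vertex_ideal_def image_iff by (auto simp: tclass_eq_iff intro: tcong.refl)

lemma Z_order_ideal_vertex_ideal:
  assumes "hereditary_saturated G H"
  shows "Z_order_ideal G (vertex_ideal G H)"
  unfolding Z_order_ideal_def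
proof (intro conjI allI ballI impI)
  show "submonoid (vertex_ideal G H) (talented_monoid G)"
  proof
    show "vertex_ideal G H \<subseteq> carrier (talented_monoid G)"
      by (auto simp: vertex_ideal_def carrier_talented_monoid)
    show "\<one>\<^bsub>talented_monoid G\<^esub> \<in> vertex_ideal G H"
      by (auto simp: vertex_ideal_def one_talented_monoid empty_free_gens)
    fix a b
    assume "a \<in> vertex_ideal G H" "b \<in> vertex_ideal G H"
    then obtain x y where "x \<in> free_gens G" "y \<in> free_gens G" "a = tclass G x" "b = tclass G y"
        "fst ` set_mset x \<subseteq> H" "fst ` set_mset y \<subseteq> H"
      unfolding vertex_ideal_def by blast
    moreover from this have "fst ` set_mset (x + y) \<subseteq> H"
      by (simp add: image_Un)
    ultimately show "a \<otimes>\<^bsub>talented_monoid G\<^esub> b \<in> vertex_ideal G H"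
      using tclass_in_vertex_ideal_iff[OF assms add_free_gens] by (simp add: tclass_mult)
  qed
next
  fix n a
  assume "a \<in> vertex_ideal G H"
  then obtain x where x: "x \<in> free_gens G" "fst ` set_mset x \<subseteq> H" "a = tclass G x"
    unfolding vertex_ideal_def by blast
  let ?y = "image_mset (\<lambda>(v, i). (v, i + n)) x"
  have "fst ` set_mset ?y = fst ` set_mset x"
    by (simp add: image_image case_prod_unfold)
  moreover from this have "?y \<in> free_gens G"
    using x(1) by (auto simp: free_gens_def)
  ultimately show "tshift n a \<in> vertex_ideal G H"
    using x by (simp add: vertex_ideal_def tshift_tclass)
next
  fix a b
  assume a: "a \<in> vertex_ideal G H" and b: "b \<in> carrier (talented_monoid G)"
    and dvd: "b divides\<^bsub>talented_monoid G\<^esub> a"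
  obtain y z where y: "y \<in> free_gens G" "b = tclass G y"
    and z: "z \<in> free_gens G" "a = tclass G (y + z)"
    using b dvd by (auto simp: factor_def carrier_talented_monoid tclass_mult)
  then have "fst ` set_mset (y + z) \<subseteq> H"
    using a tclass_in_vertex_ideal_iff[OF assms add_free_gens] by metis
  then show "b \<in> vertex_ideal G H"
    using y by (auto simp: vertex_ideal_def)
qed

lemma ideal_verts_vertex_ideal:
  assumes "hereditary_saturated G H" "v \<in> verts G"
  shows "v \<in> ideal_verts G (vertex_ideal G H) \<longleftrightarrow> v \<in> H"
  using tclass_in_vertex_ideal_iff[OF assms(1), of "{#(v, 0)#}"] assms(2)
  by (simp add: ideal_verts_def gen_def singleton_free_gens)

section \<open>The ideal generated by a vertex\<close>

lemma gen_ideal_eq: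
  assumes "v \<in> verts G"
  shows "gen_ideal G v = vertex_ideal G (hereditary_saturated G hull {v})"
  unfolding gen_ideal_def
proof (rule hull_unique)
  have "v \<in> hereditary_saturated G hull {v}"
    by (simp add: hull_inc)
  then show "{gen G v 0} \<subseteq> vertex_ideal G (hereditary_saturated G hull {v})"
    using ideal_verts_vertex_ideal[OF hereditary_saturated_hull assms]
    by (simp add: ideal_verts_def)
  show "Z_order_ideal G (vertex_ideal G (hereditary_saturated G hull {v}))"
    by (rule Z_order_ideal_vertex_ideal[OF hereditary_saturated_hull])
  fix I
  assume I: "{gen G v 0} \<subseteq> I" "Z_order_ideal G I"
  then have "hereditary_saturated G hull {v} \<subseteq> ideal_verts G I"
    by (intro hull_minimal hereditary_saturated_ideal_verts) (auto simp: ideal_verts_def)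
  then have "vertex_ideal G (hereditary_saturated G hull {v}) \<subseteq> vertex_ideal G (ideal_verts G I)"
    by (rule vertex_ideal_mono)
  also have "\<dots> = I"
    by (rule Z_order_ideal_eq[OF I(2), symmetric])
  finally show "vertex_ideal G (hereditary_saturated G hull {v}) \<subseteq> I" .
qed

lemma Z_order_ideal_gen_ideal:
  assumes "v \<in> verts G"
  shows "Z_order_ideal G (gen_ideal G v)"
  using Z_order_ideal_vertex_ideal[OF hereditary_saturated_hull] by (simp add: gen_ideal_eq[OF assms])

lemma reachable_in_ideal:
  assumes "Z_order_ideal G I" "v \<in> ideal_verts G I" "v \<rightarrow>\<^sup>* w"
  shows "w \<in> ideal_verts G I"
  using hereditary_saturated_ideal_verts[OF assms(1)] assms(2,3) by (rule hereditary_reachable)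

text \<open>
  If \<open>v\<close> does not reach \<open>w\<close>, then the ideal given by the vertices not reaching \<open>w\<close> contains \<open>v\<close>
  but not \<open>w\<close>. For \<open>w\<close> outside of \<open>PE G\<close> the equivalence can fail, because saturation may add
  \<open>w\<close> to the ideal of a vertex that \<open>w\<close> reaches.
\<close>

lemma gen_in_gen_ideal_iff:
  assumes "v \<in> verts G" "w \<in> PE G"
  shows "w \<in> ideal_verts G (gen_ideal G v) \<longleftrightarrow> v \<rightarrow>\<^sup>* w"
proof
  assume "v \<rightarrow>\<^sup>* w"
  then show "w \<in> ideal_verts G (gen_ideal G v)"
    using reachable_in_ideal[OF Z_order_ideal_gen_ideal gen_in_gen_ideal] assms(1) by blast
next
  let ?N = "{u. \<not> u \<rightarrow>\<^sup>* w}"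
  assume w: "w \<in> ideal_verts G (gen_ideal G v)"
  have N: "hereditary_saturated G ?N"
    using assms(2) by (rule hereditary_saturated_not_reaching)
  show "v \<rightarrow>\<^sup>* w"
  proof (rule ccontr)
    assume "\<not> v \<rightarrow>\<^sup>* w"
    then have "gen_ideal G v \<subseteq> vertex_ideal G ?N"
      using ideal_verts_vertex_ideal[OF N assms(1)]
      by (intro gen_ideal_subset Z_order_ideal_vertex_ideal N) auto
    then have "w \<in> ideal_verts G (vertex_ideal G ?N)"
      using w by (auto simp: ideal_verts_def)
    then show False
      using ideal_verts_vertex_ideal[OF N] PE_in_verts[OF assms(2)] by auto
  qed
qed

lemma gen_ideal_subset_iff:
  assumes "v \<in> PE G" "w \<in> PE G"
  shows "gen_ideal G w \<subseteq> gen_ideal G v \<longleftrightarrow> v \<rightarrow>\<^sup>* w"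
proof -
  have "gen_ideal G w \<subseteq> gen_ideal G v \<longleftrightarrow> w \<in> ideal_verts G (gen_ideal G v)"
    using gen_ideal_subset[OF Z_order_ideal_gen_ideal] gen_in_gen_ideal[of w G] PE_in_verts[OF assms(1)]
    by (auto simp: ideal_verts_def)
  then show ?thesis
    using gen_in_gen_ideal_iff assms PE_in_verts by blast
qed

lemma gen_ideal_eq_iff:
  assumes "v \<in> PE G" "w \<in> PE G"
  shows "gen_ideal G v = gen_ideal G w \<longleftrightarrow> PE_class G v = PE_class G w"
  using gen_ideal_subset_iff[OF assms] gen_ideal_subset_iff[OF assms(2,1)] PE_class_eq_iff[OF assms]
  by blast

section \<open>Indecomposability and simplicity\<close>

text \<open>
  The vertices not reaching \<open>w\<close> form a hereditary and saturated set without \<open>w\<close>. So if the generator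
  at \<open>w\<close> is congruent to \<open>x + y\<close>, this sum is not supported in that set, and a vertex occurring in it
  reaches \<open>w\<close>; an ideal with that vertex contains \<open>w\<close>.
\<close>

lemma PE_gen_in_set_mult:
  assumes "w \<in> PE G" "Z_order_ideal G J" "Z_order_ideal G K"
    and "gen G w 0 \<in> J <#>\<^bsub>talented_monoid G\<^esub> K"
  shows "w \<in> ideal_verts G J \<or> w \<in> ideal_verts G K"
proof -
  obtain a b where ab: "a \<in> J" "b \<in> K" "gen G w 0 = a \<otimes>\<^bsub>talented_monoid G\<^esub> b"
    using assms(4) by (auto simp: set_mult_def)
  obtain x where x: "x \<in> free_gens G" "a = tclass G x"
    using assms(2) ab(1) by (rule Z_order_idealE)
  obtain y where y: "y \<in> free_gens G" "b = tclass G y"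
    using assms(3) ab(2) by (rule Z_order_idealE)
  have w: "w \<in> verts G"
    using assms(1) by (rule PE_in_verts)
  have "tcong G {#(w, 0)#} (x + y)"
    using ab(3) x y w by (simp add: gen_def tclass_mult tclass_eq_iff singleton_free_gens)
  from tcong_supported_iff[OF this hereditary_saturated_not_reaching[OF assms(1)]]
  obtain u where u: "u \<in> fst ` set_mset (x + y)" "u \<rightarrow>\<^sup>* w"
    using w by auto
  have "fst ` set_mset x \<subseteq> ideal_verts G J" "fst ` set_mset y \<subseteq> ideal_verts G K"
    using tclass_in_ideal_iff[OF assms(2) x(1)] tclass_in_ideal_iff[OF assms(3) y(1)] ab x y
    by simp_all
  then show ?thesis
    using u reachable_in_ideal[OF assms(2)] reachable_in_ideal[OF assms(3)]
    by (auto simp: image_Un)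
qed

lemma ideal_subset_set_mult:
  assumes "Z_order_ideal G J" "Z_order_ideal G K"
  shows "J \<subseteq> J <#>\<^bsub>talented_monoid G\<^esub> K" "K \<subseteq> J <#>\<^bsub>talented_monoid G\<^esub> K"
proof -
  interpret T: comm_monoid "talented_monoid G"
    by (rule comm_monoid_talented_monoid)
  show "J \<subseteq> J <#>\<^bsub>talented_monoid G\<^esub> K"
  proof
    fix x
    assume x: "x \<in> J"
    then have "x \<otimes>\<^bsub>talented_monoid G\<^esub> \<one>\<^bsub>talented_monoid G\<^esub> \<in> J <#>\<^bsub>talented_monoid G\<^esub> K"
      using Z_order_ideal_one[OF assms(2)] unfolding set_mult_def by blast
    moreover have "x \<in> carrier (talented_monoid G)"
      using x Z_order_ideal_subset[OF assms(1)] by blast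
    ultimately show "x \<in> J <#>\<^bsub>talented_monoid G\<^esub> K"
      by simp
  qed
  show "K \<subseteq> J <#>\<^bsub>talented_monoid G\<^esub> K"
  proof
    fix x
    assume x: "x \<in> K"
    then have "\<one>\<^bsub>talented_monoid G\<^esub> \<otimes>\<^bsub>talented_monoid G\<^esub> x \<in> J <#>\<^bsub>talented_monoid G\<^esub> K"
      using Z_order_ideal_one[OF assms(1)] unfolding set_mult_def by blast
    moreover have "x \<in> carrier (talented_monoid G)"
      using x Z_order_ideal_subset[OF assms(2)] by blast
    ultimately show "x \<in> J <#>\<^bsub>talented_monoid G\<^esub> K"
      by simp
  qed
qed

text \<open>
  In a direct decomposition, the summand that contains the generator is everything, so the other
  summand lies in it and is zero.
\<close>

lemma indecomposable_gen_ideal: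
  assumes "v \<in> PE G"
  shows "indecomposable_ideal G (gen_ideal G v)"
proof -
  have no_decomposition: False
    if J: "Z_order_ideal G J" "J \<noteq> zero_ideal G" and K: "Z_order_ideal G K" "K \<noteq> zero_ideal G"
      and disj: "J \<inter> K = zero_ideal G" and dec: "gen_ideal G v = J <#>\<^bsub>talented_monoid G\<^esub> K"
    for J K
  proof -
    have "gen G v 0 \<in> J <#>\<^bsub>talented_monoid G\<^esub> K"
      using gen_in_gen_ideal[of v G] dec by (simp add: ideal_verts_def)
    then consider "v \<in> ideal_verts G J" | "v \<in> ideal_verts G K"
      using PE_gen_in_set_mult[OF assms J(1) K(1)] by blast
    then show False
    proof cases
      case 1
      then have "K \<subseteq> J"
        using gen_ideal_subset[OF J(1)] ideal_subset_set_mult[OF J(1) K(1)] dec by blast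
      then show False
        using disj K(2) by (simp add: Int_absorb1)
    next
      case 2
      then have "J \<subseteq> K"
        using gen_ideal_subset[OF K(1)] ideal_subset_set_mult[OF J(1) K(1)] dec by blast
      then show False
        using disj J(2) by (simp add: Int_absorb2)
    qed
  qed
  show ?thesis
    unfolding indecomposable_ideal_def
  proof (intro conjI notI)
    show "Z_order_ideal G (gen_ideal G v)"
      using PE_in_verts[OF assms] by (rule Z_order_ideal_gen_ideal)
  qed (elim exE conjE, rule no_decomposition)
qed

lemma gen_ideal_nonzero:
  assumes "v \<in> verts G"
  shows "gen_ideal G v \<noteq> zero_ideal G"
proof
  assume "gen_ideal G v = zero_ideal G"
  then have "tclass G {#(v, 0)#} = tclass G {#}"
    using gen_in_gen_ideal[of v G]
    by (simp add: ideal_verts_def zero_ideal_def one_talented_monoid gen_def)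
  then have "tcong G {#(v, 0)#} {#}"
    using assms by (simp add: tclass_eq_iff singleton_free_gens)
  from tcong_supported_iff[OF this hereditary_saturated_empty] show False
    by simp
qed

text \<open>
  A nonzero element involves some vertex \<open>v\<close>. The sum of generators from \<open>PE G\<close> that equals \<open>v\<close>
  cannot be empty, because only the empty multiset is supported in the empty set.
\<close>

lemma nonzero_ideal_contains_PE:
  assumes "Z_order_ideal G I" "I \<noteq> zero_ideal G"
  obtains w where "w \<in> PE G" "w \<in> ideal_verts G I"
proof -
  obtain a where a: "a \<in> I" "a \<noteq> tclass G {#}"
    using assms(2) Z_order_ideal_one[OF assms(1)]
    unfolding zero_ideal_def one_talented_monoid by blast
  obtain x where "x \<in> free_gens G" "a = tclass G x"
    using assms(1) a(1) by (rule Z_order_idealE)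
  with a have x: "x \<in> free_gens G" "tclass G x \<in> I" "tclass G x \<noteq> tclass G {#}"
    by simp_all
  then have "set_mset x \<noteq> {}"
    by auto
  then obtain p where "p \<in># x"
    by blast
  then have "fst p \<in> fst ` set_mset x" "fst ` set_mset x \<subseteq> verts G"
    using x(1) by (auto simp: free_gens_def)
  then obtain v where vI: "v \<in> ideal_verts G I" "v \<in> verts G"
    using tclass_in_ideal_iff[OF assms(1) x(1)] x(2) by blast
  obtain y where y: "tcong G {#(v, 0)#} y" "fst ` set_mset y \<subseteq> {w \<in> PE G. v \<rightarrow>\<^sup>* w}"
    using tcong_PE_sum[OF vI(2)] by blast
  have "fst ` set_mset y \<noteq> {}"
    using tcong_supported_iff[OF y(1) hereditary_saturated_empty] by auto
  then obtain w where "w \<in> PE G" "v \<rightarrow>\<^sup>* w"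
    using y(2) by blast
  then show thesis
    using that reachable_in_ideal[OF assms(1) vI(1)] by blast
qed

text \<open>
  If \<open>\<langle>v\<rangle>\<close> is simple and \<open>v\<close> reaches \<open>w\<close>, the nonzero ideal \<open>\<langle>w\<rangle>\<close> is all of \<open>\<langle>v\<rangle>\<close> and so contains
  \<open>v\<close>. Conversely, a nonzero ideal in \<open>\<langle>v\<rangle>\<close> contains some \<open>w \<in> PE G\<close>, which \<open>v\<close> reaches; once \<open>w\<close>
  reaches \<open>v\<close> again, that ideal contains \<open>v\<close>.
\<close>

lemma simple_gen_ideal_iff:
  assumes "v \<in> PE G"
  shows "simple_ideal G (gen_ideal G v) \<longleftrightarrow> (\<forall>w. v \<rightarrow>\<^sup>* w \<longrightarrow> w \<rightarrow>\<^sup>* v)"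
proof -
  have v: "v \<in> verts G"
    using assms by (rule PE_in_verts)
  show ?thesis
  proof
    assume simple: "simple_ideal G (gen_ideal G v)"
    show "\<forall>w. v \<rightarrow>\<^sup>* w \<longrightarrow> w \<rightarrow>\<^sup>* v"
    proof (intro allI impI)
      fix w
      assume vw: "v \<rightarrow>\<^sup>* w"
      then have w: "w \<in> verts G"
        by (rule reachable_in_verts)
      have "gen_ideal G w \<subseteq> gen_ideal G v"
        using reachable_in_ideal[OF Z_order_ideal_gen_ideal gen_in_gen_ideal vw] v
        by (intro gen_ideal_subset Z_order_ideal_gen_ideal) auto
      then have "gen_ideal G w = gen_ideal G v"
        using simple Z_order_ideal_gen_ideal[OF w] gen_ideal_nonzero[OF w]
        unfolding simple_ideal_def by blast
      then show "w \<rightarrow>\<^sup>* v"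
        using gen_in_gen_ideal_iff[OF w assms] gen_in_gen_ideal[of v G] by simp
    qed
  next
    assume ret: "\<forall>w. v \<rightarrow>\<^sup>* w \<longrightarrow> w \<rightarrow>\<^sup>* v"
    have "J = gen_ideal G v"
      if J: "Z_order_ideal G J" "J \<subseteq> gen_ideal G v" "J \<noteq> zero_ideal G" for J
    proof -
      obtain w where w: "w \<in> PE G" "w \<in> ideal_verts G J"
        using nonzero_ideal_contains_PE[OF J(1,3)] .
      then have "w \<in> ideal_verts G (gen_ideal G v)"
        using J(2) by (auto simp: ideal_verts_def)
      then have "w \<rightarrow>\<^sup>* v"
        using gen_in_gen_ideal_iff[OF v w(1)] ret by blast
      then have "gen_ideal G v \<subseteq> J"
        using reachable_in_ideal[OF J(1) w(2)] gen_ideal_subset[OF J(1)] by blast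
      then show ?thesis
        using J(2) by blast
    qed
    then show "simple_ideal G (gen_ideal G v)"
      unfolding simple_ideal_def
      using Z_order_ideal_gen_ideal[OF v] gen_ideal_nonzero[OF v] by blast
  qed
qed

end

section \<open>Decomposition into the ideals of maximal classes\<close>

lemma submonoid_finprod:
  assumes "comm_monoid M" "submonoid I M" "\<And>k. k \<in> F \<Longrightarrow> f k \<in> I"
  shows "finprod M f F \<in> I"
proof -
  interpret comm_monoid M by fact
  interpret I: submonoid I M by fact
  have "f \<in> F \<rightarrow> carrier M"
    using assms(3) I.subset by blast
  with assms(3) show ?thesis
    by (induction F rule: infinite_finite_induct) auto
qed

lemma ideal_sum_subset:
  assumes "Z_order_ideal E I" "\<And>k. k \<in> A \<Longrightarrow> J k \<subseteq> I"
  shows "ideal_sum E A J \<subseteq> I"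
proof -
  have "submonoid I (talented_monoid E)"
    using assms(1) by (simp add: Z_order_ideal_def)
  then show ?thesis
    unfolding ideal_sum_def
    using assms(2) by (auto intro!: submonoid_finprod[OF comm_monoid_talented_monoid])
qed

lemma ideal_sum_one: "\<one>\<^bsub>talented_monoid E\<^esub> \<in> ideal_sum E A J"
proof -
  interpret comm_monoid "talented_monoid E"
    by (rule comm_monoid_talented_monoid)
  show ?thesis
    unfolding ideal_sum_def by (auto intro!: exI[of _ "{}"])
qed

lemma ideal_sum_upper:
  assumes "Z_order_ideal E (J k)" "k \<in> A" "x \<in> J k"
  shows "x \<in> ideal_sum E A J"
proof -
  interpret comm_monoid "talented_monoid E"
    by (rule comm_monoid_talented_monoid)
  have "x \<in> carrier (talented_monoid E)"
    using assms Z_order_ideal_subset by blast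
  then have "x = finprod (talented_monoid E) (\<lambda>_. x) {k}"
    by simp
  then show ?thesis
    unfolding ideal_sum_def using assms(2,3) by (intro CollectI exI[of _ "\<lambda>_. x"] exI[of _ "{k}"]) auto
qed

text \<open>
  Sums over different finite index sets \<open>F\<close> and \<open>F'\<close> are added over \<open>F \<union> F'\<close>, padding both
  families with zeros.
\<close>

lemma ideal_sum_mult:
  assumes ideals: "\<And>k. k \<in> A \<Longrightarrow> Z_order_ideal E (J k)"
    and "x \<in> ideal_sum E A J" "y \<in> ideal_sum E A J"
  shows "x \<otimes>\<^bsub>talented_monoid E\<^esub> y \<in> ideal_sum E A J"
proof -
  interpret comm_monoid "talented_monoid E"
    by (rule comm_monoid_talented_monoid)
  let ?T = "talented_monoid E"
  have pad: "\<exists>h. z = finprod ?T h F' \<and> (\<forall>k\<in>F'. h k \<in> J k)"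
    if "z = finprod ?T f F" "F \<subseteq> F'" "finite F'" "F' \<subseteq> A" "\<forall>k\<in>F. f k \<in> J k" for z f F F'
  proof -
    define h where "h k = (if k \<in> F then f k else \<one>\<^bsub>?T\<^esub>)" for k
    have J: "Z_order_ideal E (J k)" if "k \<in> F'" for k
      using that \<open>F' \<subseteq> A\<close> ideals by blast
    have h: "\<forall>k\<in>F'. h k \<in> J k"
      using that(5) Z_order_ideal_one[OF J] by (simp add: h_def)
    then have "h \<in> F' \<rightarrow> carrier ?T"
      using Z_order_ideal_subset[OF J] by blast
    then have "finprod ?T f F = finprod ?T h F'"
      using that by (intro finprod_mono_neutral_cong_left) (auto simp: h_def)
    then show ?thesis
      using h that(1) by blast
  qed
  obtain f F g F' where f: "finite F" "F \<subseteq> A" "\<forall>k\<in>F. f k \<in> J k" "x = finprod ?T f F"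
    and g: "finite F'" "F' \<subseteq> A" "\<forall>k\<in>F'. g k \<in> J k" "y = finprod ?T g F'"
    using assms(2,3) unfolding ideal_sum_def by blast
  let ?B = "F \<union> F'"
  have B: "finite ?B" "?B \<subseteq> A"
    using f g by auto
  obtain f' where f': "x = finprod ?T f' ?B" "\<forall>k\<in>?B. f' k \<in> J k"
    using pad[OF f(4) _ B f(3)] by blast
  obtain g' where g': "y = finprod ?T g' ?B" "\<forall>k\<in>?B. g' k \<in> J k"
    using pad[OF g(4) _ B g(3)] by blast
  have "f' \<in> ?B \<rightarrow> carrier ?T" "g' \<in> ?B \<rightarrow> carrier ?T"
    using f' g' Z_order_ideal_subset ideals B(2) by blast+
  then have "x \<otimes>\<^bsub>?T\<^esub> y = finprod ?T (\<lambda>k. f' k \<otimes>\<^bsub>?T\<^esub> g' k) ?B"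
    using f' g' by simp
  moreover have "\<forall>k\<in>?B. f' k \<otimes>\<^bsub>?T\<^esub> g' k \<in> J k"
    using f'(2) g'(2) ideals B(2) unfolding Z_order_ideal_def
    by (meson subsetD submonoid.m_closed)
  ultimately show ?thesis
    unfolding ideal_sum_def using B by blast
qed

lemma tclass_in_ideal_sum:
  assumes "\<And>k. k \<in> A \<Longrightarrow> Z_order_ideal E (J k)" "x \<in> free_gens E"
    and "\<And>v i. (v, i) \<in># x \<Longrightarrow> gen E v i \<in> ideal_sum E A J"
  shows "tclass E x \<in> ideal_sum E A J"
  using assms(2,3)
proof (induction x)
  case empty
  show ?case
    using ideal_sum_one by (simp flip: one_talented_monoid)
next
  case (add p x)
  have p: "{#p#} \<in> free_gens E" and x: "x \<in> free_gens E"
    using add.prems(1) by (auto simp: free_gens_def)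
  have "tclass E {#p#} \<in> ideal_sum E A J"
    using add.prems(2)[of "fst p" "snd p"] by (simp add: gen_def)
  moreover have "tclass E x \<in> ideal_sum E A J"
    using add.IH[OF x] add.prems(2) by auto
  ultimately have "tclass E {#p#} \<otimes>\<^bsub>talented_monoid E\<^esub> tclass E x \<in> ideal_sum E A J"
    by (rule ideal_sum_mult[rotated]) (rule assms(1))
  then show ?case
    by (simp add: tclass_mult[OF p x])
qed

context fin_digraph
begin

text \<open>
  The order on classes is inclusion of the sets of vertices reached, so a maximal such set among
  the finitely many in question gives a maximal class.
\<close>

lemma maximal_class_above:
  assumes "v \<in> PE G" "v \<in> ideal_verts G I"
  obtains u where "u \<in> PE G" "u \<rightarrow>\<^sup>* v" "PE_class G u \<in> max_classes G (C_ideal G I)"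
proof -
  define R where "R u = {w. u \<rightarrow>\<^sup>* w}" for u
  let ?P = "{u \<in> PE G. gen G u 0 \<in> I}"
  have R: "u \<rightarrow>\<^sup>* w \<longleftrightarrow> R w \<subseteq> R u" if "u \<in> PE G" "w \<in> PE G" for u w
    using that PE_in_verts by (auto simp: R_def intro: reachable_trans)
  have "finite (R ` ?P)" "R v \<in> R ` ?P"
    using finite_PE assms by (auto simp: ideal_verts_def)
  then obtain u where u: "u \<in> ?P" "R v \<subseteq> R u" "\<forall>w\<in>?P. R u \<subseteq> R w \<longrightarrow> R u = R w"
    using finite_has_maximal2[of "R ` ?P" "R v"] by auto
  have "PE_class G u \<in> max_classes G (C_ideal G I)"
    unfolding max_classes_def
  proof (intro CollectI conjI ballI impI)
    show "PE_class G u \<in> C_ideal G I"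
      using u(1) by (auto simp: C_ideal_def)
    fix Y
    assume Y: "Y \<in> C_ideal G I" "class_ge G Y (PE_class G u)"
    then obtain w where w: "w \<in> ?P" "Y = PE_class G w"
      by (auto simp: C_ideal_def)
    then have "w \<rightarrow>\<^sup>* u"
      using Y(2) u(1) class_ge_PE_class[OF fin_digraph] by blast
    then have "R u \<subseteq> R w"
      using R[of w u] u(1) w(1) by simp
    then have "R u = R w"
      using u(3) w(1) by blast
    then have "u \<rightarrow>\<^sup>* w"
      using R[of u w] u(1) w(1) by simp
    with \<open>w \<rightarrow>\<^sup>* u\<close> show "Y = PE_class G u"
      using PE_class_eq_iff[of w u] u(1) w by simp
  qed
  then show thesis
    using that u R assms(1) by blast
qed

text \<open>
  The ideal is generated by its vertices, each of which is a sum of generators from \<open>PE G\<close>; such a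
  generator lies in the ideal of the representative of any maximal class above it.
\<close>

lemma ideal_decomposition:
  assumes I: "Z_order_ideal G I"
    and rep: "\<And>X. X \<in> max_classes G (C_ideal G I) \<Longrightarrow> rep X \<in> X"
  shows "I = ideal_sum G (max_classes G (C_ideal G I)) (\<lambda>X. gen_ideal G (rep X))"
    (is "I = ideal_sum G ?M ?J")
proof
  have rep_class: "rep (PE_class G u) \<in> PE G \<and> u \<rightarrow>\<^sup>* rep (PE_class G u) \<and> rep (PE_class G u) \<rightarrow>\<^sup>* u"
    if "PE_class G u \<in> ?M" for u
    using rep[OF that] by (auto simp: PE_class_def PE_rel_def)
  have repI: "rep X \<in> PE G \<and> rep X \<in> ideal_verts G I" if X: "X \<in> ?M" for X
  proof -
    obtain u where "X = PE_class G u" "u \<in> ideal_verts G I"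
      using X by (auto simp: max_classes_def C_ideal_def ideal_verts_def)
    then show ?thesis
      using rep_class[of u] X reachable_in_ideal[OF I] by blast
  qed
  then have J: "Z_order_ideal G (?J X)" if "X \<in> ?M" for X
    using that Z_order_ideal_gen_ideal PE_in_verts by blast
  show "ideal_sum G ?M ?J \<subseteq> I"
    using repI by (intro ideal_sum_subset I gen_ideal_subset) auto

  have gen_PE: "gen G v i \<in> ideal_sum G ?M ?J" if v: "v \<in> PE G" "v \<in> ideal_verts G I" for v i
  proof -
    obtain u where u: "u \<in> PE G" "u \<rightarrow>\<^sup>* v" "PE_class G u \<in> ?M"
      using maximal_class_above[OF v] .
    let ?r = "rep (PE_class G u)"
    have "?r \<rightarrow>\<^sup>* v"
      using rep_class[OF u(3)] u(2) by (blast intro: reachable_trans)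
    then have "v \<in> ideal_verts G (gen_ideal G ?r)"
      using reachable_in_ideal[OF J[OF u(3)] gen_in_gen_ideal] by blast
    then show ?thesis
      using Z_order_ideal_gen_iff[OF J[OF u(3)]] ideal_sum_upper[of G ?J, OF J[OF u(3)] u(3)]
      by blast
  qed
  have gen_sum: "gen G v i \<in> ideal_sum G ?M ?J" if v: "v \<in> verts G" "v \<in> ideal_verts G I" for v i
  proof -
    obtain y where y: "tcong G {#(v, i)#} y" "fst ` set_mset y \<subseteq> {w \<in> PE G. v \<rightarrow>\<^sup>* w}"
      using tcong_PE_sum[OF v(1)] by blast
    have "tclass G y \<in> ideal_sum G ?M ?J"
    proof (rule tclass_in_ideal_sum[OF J])
      show "y \<in> free_gens G"
        using tcong_free_gens[OF y(1)] by blast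
      fix w j
      assume "(w, j) \<in># y"
      then show "gen G w j \<in> ideal_sum G ?M ?J"
        using y(2) reachable_in_ideal[OF I v(2)] by (intro gen_PE) force+
    qed
    moreover have "gen G v i = tclass G y"
      using y(1) v(1) by (simp add: gen_def tclass_eq_iff singleton_free_gens)
    ultimately show ?thesis by simp
  qed
  show "I \<subseteq> ideal_sum G ?M ?J"
  proof
    fix a
    assume a: "a \<in> I"
    with I obtain x where x: "x \<in> free_gens G" "a = tclass G x"
      by (rule Z_order_idealE)
    then have support: "fst ` set_mset x \<subseteq> ideal_verts G I"
      using a tclass_in_ideal_iff[OF I] by blast
    show "a \<in> ideal_sum G ?M ?J"
      unfolding x(2)
    proof (rule tclass_in_ideal_sum[OF J])
      fix v i
      assume v: "(v, i) \<in># x"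
      then have "v \<in> verts G"
        using x(1) by (auto simp: free_gens_def)
      moreover have "v \<in> ideal_verts G I"
        using support v by force
      ultimately show "gen G v i \<in> ideal_sum G ?M ?J"
        by (rule gen_sum)
    qed (use x(1) in simp_all)
  qed
qed

end

theorem theorem5p1:
  fixes E :: "('v, 'e) pre_digraph"
  assumes "fin_digraph E"
  shows "(\<forall>v\<in>PE E. \<forall>w\<in>PE E. gen_ideal E v = gen_ideal E w \<longleftrightarrow> PE_class E v = PE_class E w) \<and>
    (\<forall>v\<in>PE E. indecomposable_ideal E (gen_ideal E v)) \<and>
    (\<forall>v\<in>PE E. simple_ideal E (gen_ideal E v) \<longleftrightarrow>
       sink E v \<or>
       (\<exists>c. pre_digraph.cycle E c \<and> \<not> (\<exists>f. is_exit E c f) \<and> v \<in> cycle_verts E c) \<or>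
       (\<exists>c. extreme_cycle E c \<and> v \<in> cycle_verts E c)) \<and>
    (\<forall>I. Z_order_ideal E I \<longrightarrow>
       (\<forall>rep. (\<forall>X\<in>max_classes E (C_ideal E I). rep X \<in> X) \<longrightarrow>
          I = ideal_sum E (max_classes E (C_ideal E I)) (\<lambda>X. gen_ideal E (rep X))))"
proof (intro conjI ballI allI impI)
  interpret fin_digraph E by fact
  show "gen_ideal E v = gen_ideal E w \<longleftrightarrow> PE_class E v = PE_class E w"
    if "v \<in> PE E" "w \<in> PE E" for v w
    using that by (rule gen_ideal_eq_iff)
  show "indecomposable_ideal E (gen_ideal E v)" if "v \<in> PE E" for v
    using that by (rule indecomposable_gen_ideal)
  show "simple_ideal E (gen_ideal E v) \<longleftrightarrow>
       sink E v \<or>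
       (\<exists>c. cycle c \<and> \<not> (\<exists>f. is_exit E c f) \<and> v \<in> cycle_verts E c) \<or>
       (\<exists>c. extreme_cycle E c \<and> v \<in> cycle_verts E c)" if "v \<in> PE E" for v
    unfolding simple_gen_ideal_iff[OF that] using that by (rule returning_vertex_iff)
  show "I = ideal_sum E (max_classes E (C_ideal E I)) (\<lambda>X. gen_ideal E (rep X))"
    if "Z_order_ideal E I" "\<forall>X\<in>max_classes E (C_ideal E I). rep X \<in> X" for I rep
    using that by (intro ideal_decomposition) auto
qed

end
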